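(* If $G$ is a primitive strongly regular graph, then the VC-dimension of $G$ is at least $2$.
   Context: All graphs are finite and simple. A graph $G$ on $v$ vertices is strongly regular, an $\mathrm{SRG}(v,k,\lambda,\mu)$, if every vertex has degree $k$, any two adjacent vertices have exactly $\lambda$ common neighbors, and any two distinct nonadjacent vertices have exactly $\mu$ common neighbors. $G$ is primitive if both $G$ and its complement $\overline G$ are connected (so the one-vertex graph is not considered). The VC-dimension of a graph $G$ is the maximum size of a set $S\subseteq V(G)$ that is shattered, meaning that for every $A\subseteq S$ there is a vertex $u\in V(G)$ (possibly $u\in S$) with $N(u)\cap S=A$, where $N(u)$ is the open neighborhood of $u$. *)

theory Defs
  imports "Graph_Theory.Graph_Theory"
begin

text \<open>
  A finite simple graph is a \<^locale>\<open>pair_graph\<close>: a finite vertex set \<open>pverts G\<close> together with a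
  symmetric irreflexive relation \<open>parcs G\<close> on it, so each edge contributes two arcs.
\<close>

definition nbhd :: "'a pair_pre_digraph \<Rightarrow> 'a \<Rightarrow> 'a set" where
  "nbhd G u = {w \<in> pverts G. u \<rightarrow>\<^bsub>G\<^esub> w}"

definition graph_complement :: "'a pair_pre_digraph \<Rightarrow> 'a pair_pre_digraph" where
  "graph_complement G =
    \<lparr> pverts = pverts G,
      parcs = {(u, w). u \<in> pverts G \<and> w \<in> pverts G \<and> u \<noteq> w \<and> \<not> u \<rightarrow>\<^bsub>G\<^esub> w} \<rparr>"

definition strongly_regular ::
    "'a pair_pre_digraph \<Rightarrow> nat \<Rightarrow> nat \<Rightarrow> nat \<Rightarrow> nat \<Rightarrow> bool" where
  "strongly_regular G v k l m \<longleftrightarrow>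
    pair_graph G \<and> card (pverts G) = v \<and>
    (\<forall>u \<in> pverts G. card (nbhd G u) = k) \<and>
    (\<forall>u \<in> pverts G. \<forall>w \<in> pverts G. u \<rightarrow>\<^bsub>G\<^esub> w \<longrightarrow> card (nbhd G u \<inter> nbhd G w) = l) \<and>
    (\<forall>u \<in> pverts G. \<forall>w \<in> pverts G. u \<noteq> w \<and> \<not> u \<rightarrow>\<^bsub>G\<^esub> w \<longrightarrow>
      card (nbhd G u \<inter> nbhd G w) = m)"

text \<open>
  The one-vertex graph and its complement are both connected, so it is excluded explicitly;
  the null graph is not \<^const>\<open>connected\<close>.
\<close>

definition primitive_graph :: "'a pair_pre_digraph \<Rightarrow> bool" where
  "primitive_graph G \<longleftrightarrow>
    card (pverts G) \<noteq> 1 \<and> connected G \<and> connected (graph_complement G)"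

definition shattered :: "'a pair_pre_digraph \<Rightarrow> 'a set \<Rightarrow> bool" where
  "shattered G S \<longleftrightarrow>
    S \<subseteq> pverts G \<and> (\<forall>A \<subseteq> S. \<exists>u \<in> pverts G. nbhd G u \<inter> S = A)"

text \<open>
  For a finite graph with at least one vertex, the maximum below is over a finite set that
  contains 0, because the empty set is shattered. For the null graph it is unspecified.
\<close>

definition vc_dim :: "'a pair_pre_digraph \<Rightarrow> nat" where
  "vc_dim G = Max {card S | S. shattered G S}"

end

theory Submission
  imports Defs
begin

text \<open>
  Two distinct nonadjacent vertices \<open>x\<close> and \<open>y\<close> are shattered as soon as \<open>0 < \<mu> < k\<close>: a common
  neighbor realises \<open>{x, y}\<close>, a neighbor of exactly one of them realises a singleton, and \<open>x\<close> itself
  realises the empty set. If \<open>\<mu> = 0\<close>, adjacency-or-equality is transitive, so connectedness makes \<open>G\<close>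
  complete. If \<open>\<mu> = k\<close>, nonadjacent vertices have the same neighborhood, so connectedness of the
  complement gives all vertices the same neighborhood, which is impossible as soon as there is an edge.
\<close>

text \<open>\<open>connected\<close> refers to walks in the symmetric closure, so the step must
  carry \<open>P\<close> across an arc in either direction. No symmetry of \<open>H\<close> is
  assumed.\<close>

lemma connected_induct [consumes 3, case_names base step]:
  assumes "connected (with_proj H)" "x \<in> pverts H" "y \<in> pverts H"
    and "P x"
    and step: "\<And>a b. a \<in> pverts H \<Longrightarrow> b \<in> pverts H \<Longrightarrow> (a, b) \<in> parcs H \<or> (b, a) \<in> parcs H
      \<Longrightarrow> P a \<Longrightarrow> P b"
  shows "P y"
proof -
  have "(x, y) \<in> rtrancl_on (pverts H) (parcs (mk_symmetric (with_proj H)))"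
    using assms(1-3) by (simp add: connected_def strongly_connected_def reachable_def)
  then show ?thesis
    by (induction rule: rtrancl_on_induct)
      (use assms(4) in \<open>auto simp: parcs_mk_symmetric intro: step\<close>)
qed

text \<open>Otherwise a walk starting at \<open>x\<close> could never leave \<open>x\<close>,
  although a second vertex exists.\<close>

lemma connected_has_neighbor:
  assumes "connected (with_proj H)" "x \<in> pverts H" "card (pverts H) \<noteq> 1"
  obtains y where "y \<in> pverts H" "y \<noteq> x" "(x, y) \<in> parcs H \<or> (y, x) \<in> parcs H"
proof -
  have "pverts H \<noteq> {x}"
    using assms(3) by auto
  then obtain z where z: "z \<in> pverts H" "z \<noteq> x"
    using assms(2) by blast
  have "z = x" if none: "\<nexists>y. y \<in> pverts H \<and> y \<noteq> x \<and> ((x, y) \<in> parcs H \<or> (y, x) \<in> parcs H)"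
    using assms(1,2) z(1) by (induction rule: connected_induct) (use none in auto)
  then show ?thesis
    using z that by blast
qed

lemma card_le_vc_dim:
  assumes "finite (pverts G)" "shattered G S"
  shows "card S \<le> vc_dim G"
proof -
  have "{card S | S. shattered G S} \<subseteq> card ` Pow (pverts G)"
    by (auto simp: shattered_def)
  then have "finite {card S | S. shattered G S}"
    using assms(1) finite_subset by blast
  then show ?thesis
    unfolding vc_dim_def using assms(2) by (intro Max_ge) auto
qed

lemma shattered_nonadjacent_pair:
  assumes "pair_graph G" "x \<in> pverts G" "y \<in> pverts G" "(x, y) \<notin> parcs G"
    and "nbhd G x \<inter> nbhd G y \<noteq> {}"
    and "\<not> nbhd G x \<subseteq> nbhd G y" "\<not> nbhd G y \<subseteq> nbhd G x"
  shows "shattered G {x, y}"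
proof -
  interpret pair_graph G by fact
  have sym: "(a, b) \<in> parcs G \<longleftrightarrow> (b, a) \<in> parcs G" for a b
    using pair_sym_arcs by (auto simp: symmetric_def dest: symD)
  have irrefl: "(a, a) \<notin> parcs G" for a
    using pair_no_loops by fastforce
  \<comment> \<open>Shattering looks at the neighborhoods of the witnesses, while the hypotheses
    concern those of \<open>x\<close> and \<open>y\<close>; symmetry converts one into the
    other.\<close>
  have nb: "u \<in> pverts G \<and> (u, a) \<in> parcs G" if "u \<in> nbhd G a" for u a
    using that sym by (auto simp: nbhd_def)
  have nnb: "(u, a) \<notin> parcs G" if "u \<in> pverts G" "u \<notin> nbhd G a" for u a
    using that sym by (auto simp: nbhd_def)
  obtain p q r where p: "p \<in> nbhd G x" "p \<in> nbhd G y" and q: "q \<in> nbhd G x" "q \<notin> nbhd G y"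
    and r: "r \<in> nbhd G y" "r \<notin> nbhd G x"
    using assms(5-7) by blast
  have "nbhd G p \<inter> {x, y} = {x, y}"
    using nb p assms(2,3) by (auto simp: nbhd_def)
  moreover have "nbhd G q \<inter> {x, y} = {x}"
    using nb[OF q(1)] nnb q(2) assms(2) by (auto simp: nbhd_def)
  moreover have "nbhd G r \<inter> {x, y} = {y}"
    using nb[OF r(1)] nnb r(2) assms(3) by (auto simp: nbhd_def)
  moreover have "nbhd G x \<inter> {x, y} = {}"
    using assms(4) irrefl by (auto simp: nbhd_def)
  moreover have "A = {} \<or> A = {x} \<or> A = {y} \<or> A = {x, y}" if "A \<subseteq> {x, y}" for A
    using that by blast
  moreover have "p \<in> pverts G" "q \<in> pverts G" "r \<in> pverts G"
    using nb p q r by blast+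
  ultimately show ?thesis
    unfolding shattered_def using assms(2,3) by (metis empty_subsetI insert_subset)
qed

theorem proposition22:
  fixes G :: "'a pair_pre_digraph" and v k l m :: nat
  assumes "strongly_regular G v k l m"
    and "primitive_graph G"
  shows "vc_dim G \<ge> 2"
proof -
  have deg: "card (nbhd G u) = k" if "u \<in> pverts G" for u
    using assms(1) that by (simp add: strongly_regular_def)
  have common: "card (nbhd G u \<inter> nbhd G w) = m"
      if "u \<in> pverts G" "w \<in> pverts G" "u \<noteq> w" "(u, w) \<notin> parcs G" for u w
    using assms(1) that by (auto simp: strongly_regular_def)
  have conn: "connected (with_proj G)" and conn': "connected (with_proj (graph_complement G))"
    and card1: "card (pverts G) \<noteq> 1"
    using assms(2) by (auto simp: primitive_graph_def)
  have pg: "pair_graph G"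
    using assms(1) by (simp add: strongly_regular_def)
  interpret pair_graph G by fact
  have sym: "(a, b) \<in> parcs G \<longleftrightarrow> (b, a) \<in> parcs G" for a b
    using pair_sym_arcs by (auto simp: symmetric_def dest: symD)
  have fin: "finite (nbhd G a)" for a
    using pair_finite_verts by (simp add: nbhd_def)
  have compl: "pverts (graph_complement G) = pverts G"
    "(a, b) \<in> parcs (graph_complement G) \<longleftrightarrow>
      a \<in> pverts G \<and> b \<in> pverts G \<and> a \<noteq> b \<and> (a, b) \<notin> parcs G" for a b
    by (auto simp: graph_complement_def)
  obtain x where x: "x \<in> pverts G"
    using conn by (auto simp: connected_def strongly_connected_def)
  \<comment> \<open>A neighbor of \<open>x\<close> in the complement completes the pair to be
    shattered.\<close>
  obtain y where y: "y \<in> pverts G" "y \<noteq> x" "(x, y) \<notin> parcs G"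
    using connected_has_neighbor[OF conn', of x] x card1 sym unfolding compl by metis
  obtain w where w: "w \<in> pverts G" "(x, w) \<in> parcs G"
    using connected_has_neighbor[OF conn x card1] sym by metis
  have "m \<noteq> 0"
  proof
    assume "m = 0"
    have "y = x \<or> (x, y) \<in> parcs G"
      using conn x y(1)
    proof (induction rule: connected_induct)
      case (step a b)
      show ?case
      proof (rule ccontr)
        assume b: "\<not> (b = x \<or> (x, b) \<in> parcs G)"
        \<comment> \<open>Here \<open>a\<close> is not \<open>x\<close>, since \<open>b\<close> is
          adjacent to \<open>a\<close> but not to \<open>x\<close>; so \<open>a\<close> is adjacent
          to both.\<close>
        then have "a \<in> nbhd G x \<inter> nbhd G b"
          using step sym by (auto simp: nbhd_def)
        moreover have "nbhd G x \<inter> nbhd G b = {}"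
          using common[of x b] \<open>m = 0\<close> b x step(2) fin by auto
        ultimately show False by blast
      qed
    qed simp
    then show False using y by simp
  qed
  have "m \<noteq> k"
  proof
    assume "m = k"
    have "x \<in> pverts (graph_complement G)" "w \<in> pverts (graph_complement G)"
      using w x by (simp_all add: compl)
    \<comment> \<open>Although \<open>w\<close> is adjacent to \<open>x\<close> in \<open>G\<close>,
      a walk in the complement joins them. Equality of neighborhoods passes along it and would put a
      loop at \<open>w\<close>.\<close>
    with conn' have "nbhd G w = nbhd G x"
    proof (induction rule: connected_induct)
      case (step a b)
      then have ab: "a \<in> pverts G" "b \<in> pverts G" "a \<noteq> b" "(a, b) \<notin> parcs G"
        using sym by (auto simp: compl)
      then have "card (nbhd G a \<inter> nbhd G b) = k"
        using common \<open>m = k\<close> by blast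
      \<comment> \<open>The intersection has the size \<open>k\<close> of each finite neighborhood
        containing it, so it is all of both.\<close>
      then have "nbhd G a \<inter> nbhd G b = nbhd G a" "nbhd G a \<inter> nbhd G b = nbhd G b"
        using deg ab fin by (intro card_subset_eq; simp)+
      then show ?case using step by simp
    qed simp
    moreover have "w \<in> nbhd G x"
      using w by (simp add: nbhd_def)
    ultimately show False
      using pair_no_loops by (fastforce simp: nbhd_def)
  qed
  have xy: "card (nbhd G x \<inter> nbhd G y) = m"
    using common x y by blast
  have "shattered G {x, y}"
  proof (rule shattered_nonadjacent_pair[OF pg x y(1,3)])
    show "nbhd G x \<inter> nbhd G y \<noteq> {}"
      using xy \<open>m \<noteq> 0\<close> by auto
    \<comment> \<open>An inclusion would make the intersection a whole neighborhood, of size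
      \<open>k\<close> instead of \<open>m\<close>.\<close>
    show "\<not> nbhd G x \<subseteq> nbhd G y"
      using xy \<open>m \<noteq> k\<close> deg[OF x] by (metis inf.absorb1)
    show "\<not> nbhd G y \<subseteq> nbhd G x"
      using xy \<open>m \<noteq> k\<close> deg[OF y(1)] by (metis inf.absorb2)
  qed
  then have "card {x, y} \<le> vc_dim G"
    by (rule card_le_vc_dim[OF pair_finite_verts])
  then show ?thesis
    using y(2) by simp
qed

end
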